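(* Let $q$ be a prime power, $m,l,k$ integers with $3\le k\le\min\{m+1,l\}$, and $1\le r\le k-1$. Let $\langle 1,u_1,\dots,u_r\rangle$ and $\langle 1,u_1',\dots,u_r'\rangle$ be two $(r+1)$-dimensional $\mathrm{GF}(q)$-subspaces of $\mathrm{GF}(q^l)$. Then the $G$-orbit $T(u_1,\dots,u_r)^G$ contains $T(u_1',\dots,u_r')$ if and only if the $H$-orbit $\langle 1,u_1,\dots,u_r\rangle^H$ contains $\langle 1,u_1',\dots,u_r'\rangle$.
   Context: $V$ is an $m$-dimensional vector space over $\mathrm{GF}(q^l)$ with basis $Y_1,\dots,Y_m$, regarded also as an $ml$-dimensional space over $\mathrm{GF}(q)$. $G=\mathrm{GL}(m,q^l)$ acts $\mathrm{GF}(q^l)$-linearly on $V$ and hence on its $\mathrm{GF}(q)$-subspaces; $W^G=\{g(W):g\in G\}$. $H$ is a Singer cycle of $\mathrm{GF}(q^l)$, i.e. the group of multiplications by elements of $\mathrm{GF}(q^l)^*$, acting on the $\mathrm{GF}(q)$-subspaces of $\mathrm{GF}(q^l)$; $W^H$ denotes the $H$-orbit of $W$. $\langle\cdot\rangle$ denotes $\mathrm{GF}(q)$-span. For $u_1,\dots,u_r\in\mathrm{GF}(q^l)$ with $1,u_1,\dots,u_r$ linearly independent over $\mathrm{GF}(q)$, $$T(u_1,\dots,u_r)=\langle Y_1,\dots,Y_{k-1},\,u_1Y_1+\cdots+u_rY_r\rangle,$$ a $k$-dimensional $\mathrm{GF}(q)$-subspace of $V$. *)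

theory Defs
  imports "HOL-Library.Cardinality" "HOL-Number_Theory.Prime_Powers"
begin

text \<open>
  GF(q) and GF(q^l) are finite field types \<open>'k\<close> and \<open>'a\<close>; the inclusion of the former in the
  latter is an embedding \<open>\<iota> :: 'k \<Rightarrow> 'a\<close>.  A space over \<open>'a\<close> becomes a space over \<open>'k\<close> through
  \<open>\<iota>\<close>, so that spans and dimensions over GF(q) are the library's \<open>module.span\<close> and
  \<open>vector_space.dim\<close> for the restricted scalar multiplication.
\<close>

definition field_embedding :: "('k::field \<Rightarrow> 'a::field) \<Rightarrow> bool" where
  "field_embedding \<iota> \<longleftrightarrow>
     \<iota> 1 = 1 \<and> (\<forall>x y. \<iota> (x + y) = \<iota> x + \<iota> y) \<and> (\<forall>x y. \<iota> (x * y) = \<iota> x * \<iota> y)"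

definition restrict_scalars :: "('k \<Rightarrow> 'a) \<Rightarrow> ('a \<Rightarrow> 'v \<Rightarrow> 'v) \<Rightarrow> 'k \<Rightarrow> 'v \<Rightarrow> 'v" where
  "restrict_scalars \<iota> scale = (\<lambda>c v. scale (\<iota> c) v)"

lemma vector_space_restrict_scalars:
  fixes scale :: "'a::field \<Rightarrow> 'v::ab_group_add \<Rightarrow> 'v" and \<iota> :: "'k::field \<Rightarrow> 'a"
  assumes "vector_space scale" and "field_embedding \<iota>"
  shows "vector_space (restrict_scalars \<iota> scale)"
proof -
  interpret vector_space scale by fact
  show ?thesis
    using assms(2)
    by unfold_locales
      (auto simp: field_embedding_def restrict_scalars_def scale_right_distrib scale_left_distrib)
qed

definition general_linear_group ::
    "('a::field \<Rightarrow> 'v::ab_group_add \<Rightarrow> 'v) \<Rightarrow> ('v \<Rightarrow> 'v) set" where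
  "general_linear_group scale = {g. Vector_Spaces.linear scale scale g \<and> bij g}"

definition singer_cycle :: "('a::field \<Rightarrow> 'a) set" where
  "singer_cycle = {(\<lambda>x. c * x) | c. c \<noteq> 0}"

definition subspace_orbit :: "('v \<Rightarrow> 'v) set \<Rightarrow> 'v set \<Rightarrow> 'v set set" where
  "subspace_orbit G W = {g ` W | g. g \<in> G}"

text \<open>Families such as \<open>Y\<close> and \<open>u\<close> are indexed from 1; values at other indices are irrelevant.\<close>

definition is_ordered_basis ::
    "('a::field \<Rightarrow> 'v::ab_group_add \<Rightarrow> 'v) \<Rightarrow> nat \<Rightarrow> (nat \<Rightarrow> 'v) \<Rightarrow> bool" where
  "is_ordered_basis scale m Y \<longleftrightarrow>
     inj_on Y {1..m} \<and> \<not> module.dependent scale (Y ` {1..m}) \<and>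
     module.span scale (Y ` {1..m}) = UNIV"

definition U_space :: "('k::field \<Rightarrow> 'a::field) \<Rightarrow> nat \<Rightarrow> (nat \<Rightarrow> 'a) \<Rightarrow> 'a set" where
  "U_space \<iota> r u = module.span (restrict_scalars \<iota> (*)) (insert 1 (u ` {1..r}))"

definition T_space ::
    "('k::field \<Rightarrow> 'a::field) \<Rightarrow> ('a \<Rightarrow> 'v::ab_group_add \<Rightarrow> 'v) \<Rightarrow> (nat \<Rightarrow> 'v) \<Rightarrow> nat \<Rightarrow> nat
      \<Rightarrow> (nat \<Rightarrow> 'a) \<Rightarrow> 'v set" where
  "T_space \<iota> scale Y k r u =
     module.span (restrict_scalars \<iota> scale)
       (insert (\<Sum>i=1..r. scale (u i) (Y i)) (Y ` {1..k-1}))"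

end

theory Submission imports Defs begin

text \<open>
  Write \<open>t\<^sub>0 = - (u\<^sub>1 Y\<^sub>1 + \<dots> + u\<^sub>r Y\<^sub>r)\<close>, \<open>t\<^sub>i = Y\<^sub>i\<close> for \<open>1 \<le> i < k\<close>. These span
  \<open>T(u)\<close> over GF(q), and up to a scalar the only GF(q^l)-linear relation among them has the
  coefficients \<open>1, u\<^sub>1, \<dots>, u\<^sub>r, 0, \<dots>, 0\<close>, whose GF(q)-span is \<open>\<langle>1, u\<^sub>1, \<dots>, u\<^sub>r\<rangle>\<close>.
  Changing the GF(q)-basis of \<open>T(u)\<close> or applying an element of \<open>G\<close> only changes the relation by
  an invertible matrix over GF(q), so this span is determined by the orbit up to a scalar.
  Conversely, a matrix over GF(q) relating the two coefficient vectors up to a scalar prescribes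
  the images of \<open>Y\<^sub>1, \<dots>, Y\<^sub>r\<close> under a suitable \<open>g\<close>.
\<close>

section \<open>Spans and independence of finite indexed families\<close>

text \<open>Indexing allows repetitions, so coefficients can serve directly as matrix entries even
  for families that are not injective, such as coefficient vectors padded with zeros.\<close>

lemma (in module) span_family:
  assumes "finite I"
  shows "span (f ` I) = range (\<lambda>e. \<Sum>i\<in>I. e i *s f i)"
proof (rule span_subspace)
  show "f ` I \<subseteq> range (\<lambda>e. \<Sum>i\<in>I. e i *s f i)"
  proof clarify
    fix i assume "i \<in> I"
    then have "(\<Sum>j\<in>I. (if j = i then 1 else 0) *s f j) = f i"
      using assms by (simp add: if_distrib[where f="\<lambda>c. c *s _"] sum.delta cong: if_cong)
    then show "f i \<in> range (\<lambda>e. \<Sum>i\<in>I. e i *s f i)"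
      by (intro range_eqI[of _ _ "\<lambda>j. if j = i then 1 else 0"]) (rule sym)
  qed
  show "range (\<lambda>e. \<Sum>i\<in>I. e i *s f i) \<subseteq> span (f ` I)"
    by (auto intro: span_sum span_scale span_base)
  show "subspace (range (\<lambda>e. \<Sum>i\<in>I. e i *s f i))"
  proof (rule subspaceI)
    show "0 \<in> range (\<lambda>e. \<Sum>i\<in>I. e i *s f i)"
      by (rule range_eqI[of _ _ "\<lambda>_. 0"]) simp
  next
    fix x y assume "x \<in> range (\<lambda>e. \<Sum>i\<in>I. e i *s f i)" "y \<in> range (\<lambda>e. \<Sum>i\<in>I. e i *s f i)"
    then obtain a b where "x = (\<Sum>i\<in>I. a i *s f i)" "y = (\<Sum>i\<in>I. b i *s f i)" by auto
    then show "x + y \<in> range (\<lambda>e. \<Sum>i\<in>I. e i *s f i)"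
      by (intro range_eqI[of _ _ "\<lambda>i. a i + b i"]) (simp add: scale_left_distrib sum.distrib)
  next
    fix c x assume "x \<in> range (\<lambda>e. \<Sum>i\<in>I. e i *s f i)"
    then obtain a where "x = (\<Sum>i\<in>I. a i *s f i)" by auto
    then show "c *s x \<in> range (\<lambda>e. \<Sum>i\<in>I. e i *s f i)"
      by (intro range_eqI[of _ _ "\<lambda>i. c * a i"]) (simp add: scale_sum_right)
  qed
qed

lemma (in module) independent_family_coeff:
  assumes "finite I" "inj_on f I" "independent (f ` I)"
    and "(\<Sum>i\<in>I. c i *s f i) = 0" "i \<in> I"
  shows "c i = 0"
proof -
  have "(\<Sum>v\<in>f ` I. c (the_inv_into I f v) *s v) = (\<Sum>i\<in>I. c i *s f i)"
    using assms(2) by (simp add: sum.reindex the_inv_into_f_f)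
  then have "c (the_inv_into I f (f i)) = 0"
    using assms by (intro independentD[of "f ` I" "f ` I" "\<lambda>v. c (the_inv_into I f v)"]) auto
  then show ?thesis
    using assms by (simp add: the_inv_into_f_f)
qed

lemma (in vector_space) independent_family_if_dim:
  assumes "finite I" "dim (f ` I) = card I"
  shows "inj_on f I" "independent (f ` I)"
proof -
  obtain B where B: "B \<subseteq> f ` I" "independent B" "card B = dim (f ` I)"
    by (rule basis_exists)
  have "card (f ` I) \<le> card I" using assms(1) by (rule card_image_le)
  moreover have "card B \<le> card (f ` I)" using assms(1) B by (intro card_mono) auto
  ultimately have eq: "B = f ` I"
    using B assms by (intro card_subset_eq) auto
  then show "independent (f ` I)" using B by simp
  show "inj_on f I" using assms B eq by (auto intro: eq_card_imp_inj_on)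
qed

section \<open>Restriction of scalars along the field embedding\<close>

locale restricted_space = vector_space scale
  for scale :: "'a::field \<Rightarrow> 'v::ab_group_add \<Rightarrow> 'v" +
  fixes \<iota> :: "'k::field \<Rightarrow> 'a"
  assumes embedding: "field_embedding \<iota>"
begin

text \<open>Two structures over the small field are in play: \<open>K\<close> on the ambient space,
  where \<open>T_space\<close> lives, and \<open>L\<close> on the large field itself, where
  \<open>U_space\<close> lives.\<close>

sublocale K: vector_space "restrict_scalars \<iota> scale"
  using vector_space_axioms embedding by (rule vector_space_restrict_scalars)

sublocale L: vector_space "restrict_scalars \<iota> (*)"
  by (rule vector_space_restrict_scalars[OF _ embedding]) (unfold_locales; simp add: algebra_simps)

lemma \<iota>_add: "\<iota> (x + y) = \<iota> x + \<iota> y"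
  and \<iota>_mult: "\<iota> (x * y) = \<iota> x * \<iota> y"
  and \<iota>_1: "\<iota> 1 = 1"
  using embedding by (auto simp: field_embedding_def)

lemma \<iota>_0: "\<iota> 0 = 0"
proof -
  have "\<iota> 0 + \<iota> 0 = \<iota> 0" using \<iota>_add[of 0 0] by simp
  then show ?thesis by (metis add_cancel_right_right)
qed

lemma \<iota>_uminus: "\<iota> (- x) = - \<iota> x"
  using \<iota>_add[of x "- x"] by (simp add: \<iota>_0 eq_neg_iff_add_eq_0 add.commute)

lemma \<iota>_sum: "\<iota> (sum f A) = (\<Sum>i\<in>A. \<iota> (f i))"
  by (induction A rule: infinite_finite_induct) (auto simp: \<iota>_0 \<iota>_add)

lemma \<iota>_eq_0: "\<iota> x = 0 \<longleftrightarrow> x = 0"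
proof
  assume "\<iota> x = 0"
  then have "\<iota> (x * inverse x) = 0" by (simp add: \<iota>_mult)
  then show "x = 0" by (cases "x = 0") (auto simp: \<iota>_1)
qed (simp add: \<iota>_0)

lemmas \<iota>_simps = \<iota>_add \<iota>_mult \<iota>_1 \<iota>_0 \<iota>_uminus \<iota>_sum \<iota>_eq_0

lemma K_span_family:
  "finite I \<Longrightarrow> K.span (f ` I) = range (\<lambda>e. \<Sum>i\<in>I. scale (\<iota> (e i)) (f i))"
  by (subst K.span_family) (auto simp: restrict_scalars_def)

lemma L_span_family:
  "finite I \<Longrightarrow> L.span (f ` I) = range (\<lambda>e. \<Sum>i\<in>I. \<iota> (e i) * f i)"
  by (subst L.span_family) (auto simp: restrict_scalars_def)

lemma mult_image_span: "(*) d ` L.span S = L.span ((*) d ` S)"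
proof -
  interpret module_hom "restrict_scalars \<iota> (*)" "restrict_scalars \<iota> (*)" "(*) d"
    by unfold_locales (auto simp: restrict_scalars_def algebra_simps)
  show ?thesis by (rule span_image[symmetric])
qed

lemma linear_image_span:
  assumes "Vector_Spaces.linear scale scale g"
  shows "g ` K.span S = K.span (g ` S)"
proof -
  interpret g: Vector_Spaces.linear scale scale g by fact
  interpret module_hom "restrict_scalars \<iota> scale" "restrict_scalars \<iota> scale" g
    by unfold_locales (auto simp: restrict_scalars_def g.add g.scale)
  show ?thesis by (rule span_image[symmetric])
qed

section \<open>Transport of linear relations by matrices over the small field\<close>

lemma sum_scale_swap:
  "(\<Sum>i\<in>A. scale (f i) (\<Sum>j\<in>B. scale (h i j) (w j)))
    = (\<Sum>j\<in>B. scale (\<Sum>i\<in>A. f i * h i j) (w j))"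
proof -
  have "(\<Sum>i\<in>A. scale (f i) (\<Sum>j\<in>B. scale (h i j) (w j)))
      = (\<Sum>i\<in>A. \<Sum>j\<in>B. scale (f i * h i j) (w j))"
    by (simp add: scale_sum_right)
  also have "\<dots> = (\<Sum>j\<in>B. \<Sum>i\<in>A. scale (f i * h i j) (w j))" by (rule sum.swap)
  finally show ?thesis by (simp add: scale_sum_left)
qed

text \<open>Over the small field, \<open>g\<close> has a matrix \<open>a\<close> from
  \<open>t\<close> to \<open>t'\<close>, and \<open>b\<close> is its inverse. Applying
  \<open>g\<close> to the relation \<open>x\<close> gives the relation \<open>x a\<close> among the
  \<open>t'\<close>, which is a multiple of \<open>x'\<close> by uniqueness; multiplying by
  \<open>b\<close> returns to \<open>x\<close>. Hence \<open>x\<close> and that multiple of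
  \<open>x'\<close> have the same span over the small field.\<close>

lemma relation_span_transfer:
  fixes t t' :: "nat \<Rightarrow> 'v" and x x' :: "nat \<Rightarrow> 'a"
  assumes g: "Vector_Spaces.linear scale scale g" "inj g"
    and image: "g ` K.span (t ` {..n}) = K.span (t' ` {..n})"
    and indep: "\<And>e i. (\<Sum>i\<le>n. scale (\<iota> (e i)) (t i)) = 0 \<Longrightarrow> i \<le> n \<Longrightarrow> e i = 0"
    and rel: "(\<Sum>i\<le>n. scale (x i) (t i)) = 0" and "x 0 \<noteq> 0"
    and rel': "\<And>d i. (\<Sum>i\<le>n. scale (d i) (t' i)) = 0 \<Longrightarrow> i \<le> n \<Longrightarrow> d i = d 0 * x' i"
  shows "\<exists>d. d \<noteq> 0 \<and> L.span (x ` {..n}) = (*) d ` L.span (x' ` {..n})"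
proof -
  interpret g: Vector_Spaces.linear scale scale g by fact
  have "\<exists>e. g (t i) = (\<Sum>j\<le>n. scale (\<iota> (e j)) (t' j))" if "i \<le> n" for i
  proof -
    have "g (t i) \<in> K.span (t' ` {..n})"
      unfolding image[symmetric] using that by (auto intro: K.span_base)
    then show ?thesis by (auto simp: K_span_family)
  qed
  then obtain a where a: "\<And>i. i \<le> n \<Longrightarrow> g (t i) = (\<Sum>j\<le>n. scale (\<iota> (a i j)) (t' j))"
    by metis
  have "\<exists>e. t' j = (\<Sum>i\<le>n. scale (\<iota> (e i)) (g (t i)))" if "j \<le> n" for j
  proof -
    have "t' j \<in> K.span ((\<lambda>i. g (t i)) ` {..n})"
      using that linear_image_span[OF g(1), of "t ` {..n}"] image
      by (auto simp: image_image intro: K.span_base)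
    then show ?thesis by (auto simp: K_span_family)
  qed
  then obtain b where b: "\<And>j. j \<le> n \<Longrightarrow> t' j = (\<Sum>i\<le>n. scale (\<iota> (b j i)) (g (t i)))"
    by metis
  \<comment> \<open>Going from \<open>g (t i)\<close> to \<open>t'\<close> and back, then cancelling
    the injective \<open>g\<close>, yields a second expansion of \<open>t i\<close> in the family
    \<open>t\<close>; independence over the small field identifies it with the trivial one.\<close>
  have ab: "(\<Sum>j\<le>n. a i j * b j k) = (if k = i then 1 else 0)" if "i \<le> n" "k \<le> n" for i k
  proof -
    have "g (t i) = (\<Sum>j\<le>n. scale (\<iota> (a i j)) (\<Sum>k\<le>n. scale (\<iota> (b j k)) (g (t k))))"
      using a[OF that(1)] b by simp
    also have "\<dots> = g (\<Sum>k\<le>n. scale (\<iota> (\<Sum>j\<le>n. a i j * b j k)) (t k))"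
      by (simp add: sum_scale_swap g.sum g.scale \<iota>_simps)
    finally have "t i = (\<Sum>k\<le>n. scale (\<iota> (\<Sum>j\<le>n. a i j * b j k)) (t k))"
      using g(2) by (simp add: inj_eq)
    moreover have "t i = (\<Sum>k\<le>n. scale (\<iota> (if k = i then 1 else 0)) (t k))"
      using that by (simp add: if_distrib[where f="\<lambda>c. scale (\<iota> c) _"] \<iota>_simps cong: if_cong)
    ultimately have
      "(\<Sum>k\<le>n. scale (\<iota> ((\<Sum>j\<le>n. a i j * b j k) - (if k = i then 1 else 0))) (t k)) = 0"
      by (simp only: diff_conv_add_uminus \<iota>_add \<iota>_uminus scale_left_distrib scale_minus_left
          sum.distrib sum_negf) simp
    from indep[OF this that(2)] show ?thesis by simp
  qed
  \<comment> \<open>The row vector \<open>x\<close> times the matrix \<open>a\<close>: the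
    coefficients of the image relation with respect to \<open>t'\<close>.\<close>
  define d where "d j = (\<Sum>i\<le>n. x i * \<iota> (a i j))" for j
  have "(\<Sum>j\<le>n. scale (d j) (t' j)) = g (\<Sum>i\<le>n. scale (x i) (t i))"
    by (simp add: g.sum g.scale a sum_scale_swap d_def)
  then have "(\<Sum>j\<le>n. scale (d j) (t' j)) = 0" by (simp add: rel)
  then have d: "d j = d 0 * x' j" if "j \<le> n" for j
    using rel' that by blast
  have x: "x k = (\<Sum>j\<le>n. \<iota> (b j k) * (d 0 * x' j))" if "k \<le> n" for k
  proof -
    have "(\<Sum>j\<le>n. \<iota> (b j k) * (d 0 * x' j)) = (\<Sum>j\<le>n. \<iota> (b j k) * d j)"
      by (intro sum.cong) (auto simp: d[symmetric])
    also have "\<dots> = (\<Sum>j\<le>n. \<Sum>i\<le>n. x i * (\<iota> (a i j) * \<iota> (b j k)))"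
      by (simp add: d_def sum_distrib_left algebra_simps)
    also have "\<dots> = (\<Sum>i\<le>n. \<Sum>j\<le>n. x i * (\<iota> (a i j) * \<iota> (b j k)))"
      by (rule sum.swap)
    also have "\<dots> = (\<Sum>i\<le>n. x i * \<iota> (\<Sum>j\<le>n. a i j * b j k))"
      by (simp add: \<iota>_simps sum_distrib_left)
    also have "\<dots> = (\<Sum>i\<le>n. if k = i then x i else 0)"
      using that by (intro sum.cong) (auto simp: ab \<iota>_simps)
    also have "\<dots> = x k" using that by simp
    finally show ?thesis by simp
  qed
  \<comment> \<open>If the factor \<open>d 0\<close> vanished, the recovered vector \<open>x\<close>
    would be zero, also at index 0.\<close>
  have "d 0 \<noteq> 0" using x[of 0] \<open>x 0 \<noteq> 0\<close> by auto
  moreover have "L.span (x ` {..n}) = L.span ((\<lambda>j. d 0 * x' j) ` {..n})"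
    unfolding L.span_eq
  proof safe
    fix k assume "k \<le> n"
    then show "x k \<in> L.span ((\<lambda>j. d 0 * x' j) ` {..n})"
      using x by (auto simp: L_span_family)
    show "d 0 * x' k \<in> L.span (x ` {..n})"
      using d[OF \<open>k \<le> n\<close>, symmetric]
      by (auto simp: L_span_family d_def mult.commute)
  qed
  ultimately show ?thesis by (auto simp: mult_image_span image_image)
qed

section \<open>The generators of the two spaces and their linear relation\<close>

text \<open>Index 0 carries the extra generator 1, and the zeros beyond \<open>r\<close> make this a
  coefficient vector for longer families as well.\<close>

definition coeff_family :: "nat \<Rightarrow> (nat \<Rightarrow> 'a) \<Rightarrow> nat \<Rightarrow> 'a" where
  "coeff_family r u i = (if i = 0 then 1 else if i \<le> r then u i else 0)"

text \<open>The minus sign at index 0 turns \<open>coeff_family\<close> itself into the coefficients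
  of a linear relation; the span is insensitive to it.\<close>

definition T_family :: "(nat \<Rightarrow> 'v) \<Rightarrow> nat \<Rightarrow> (nat \<Rightarrow> 'a) \<Rightarrow> nat \<Rightarrow> 'v" where
  "T_family Y r u i = (if i = 0 then - (\<Sum>i=1..r. scale (u i) (Y i)) else Y i)"

lemma atMost_eq_insert: "{..n::nat} = insert 0 {1..n}"
  by auto

lemma U_space_eq_span: "U_space \<iota> r u = L.span (coeff_family r u ` {..r})"
proof -
  have "coeff_family r u ` {1..r} = u ` {1..r}"
    by (intro image_cong) (auto simp: coeff_family_def)
  then show ?thesis
    unfolding U_space_def atMost_eq_insert image_insert by (simp add: coeff_family_def)
qed

lemma U_space_eq_span_extended:
  assumes "r \<le> n"
  shows "U_space \<iota> r u = L.span (coeff_family r u ` {..n})"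
proof -
  have "coeff_family r u i \<in> L.span (coeff_family r u ` {..r})" if "i \<le> n" for i
    by (cases "i \<le> r") (auto simp: coeff_family_def L.span_zero intro: L.span_base)
  moreover have "coeff_family r u ` {..r} \<subseteq> L.span (coeff_family r u ` {..n})"
    using assms by (auto intro: L.span_base)
  ultimately show ?thesis unfolding U_space_eq_span L.span_eq by auto
qed

lemma T_space_eq_span: "T_space \<iota> scale Y k r u = K.span (T_family Y r u ` {..k - 1})"
proof -
  have *: "T_family Y r u ` {..k - 1} = insert (- (\<Sum>i=1..r. scale (u i) (Y i))) (Y ` {1..k - 1})"
    unfolding atMost_eq_insert image_insert
    by (intro arg_cong2[where f=insert] image_cong) (auto simp: T_family_def)
  show ?thesis
    unfolding T_space_def * K.span_eq
    using K.span_neg[OF K.span_base, of "- (\<Sum>i=1..r. scale (u i) (Y i))"]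
    by (auto intro: K.span_base K.span_neg)
qed

lemma coeff_family_independent:
  assumes "L.dim (U_space \<iota> r u) = r + 1"
    and "(\<Sum>i\<le>r. \<iota> (e i) * coeff_family r u i) = 0" "i \<le> r"
  shows "e i = 0"
proof -
  have "L.dim (coeff_family r u ` {..r}) = card {..r}"
    using assms(1) by (simp add: U_space_eq_span L.dim_span)
  from L.independent_family_if_dim[OF _ this] show ?thesis
    using L.independent_family_coeff[of "{..r}" "coeff_family r u" e i] assms(2,3)
    by (auto simp: restrict_scalars_def)
qed

text \<open>Eliminating the generator at index 0 rewrites a combination in the basis vectors alone,
  so that relations can be read off coefficient by coefficient.\<close>

lemma T_family_sum:
  assumes "r \<le> n"
  shows "(\<Sum>i\<le>n. scale (d i) (T_family Y r u i))
    = (\<Sum>i=1..n. scale (d i - d 0 * coeff_family r u i) (Y i))"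
proof -
  have *: "(\<Sum>i=1..r. scale (u i) (Y i)) = (\<Sum>i=1..n. scale (coeff_family r u i) (Y i))"
    using assms by (intro sum.mono_neutral_cong_left) (auto simp: coeff_family_def)
  have "(\<Sum>i\<le>n. scale (d i) (T_family Y r u i))
      = scale (d 0) (- (\<Sum>i=1..r. scale (u i) (Y i))) + (\<Sum>i=1..n. scale (d i) (Y i))"
    unfolding atMost_eq_insert by (simp add: T_family_def)
  then show ?thesis
    unfolding * by (simp add: scale_left_diff_distrib sum_subtractf scale_sum_right)
qed

lemma T_family_relation: "(\<Sum>i\<le>r. scale (coeff_family r u i) (T_family Y r u i)) = 0"
  by (simp add: T_family_sum coeff_family_def)

lemma T_family_relation_unique:
  assumes "is_ordered_basis scale m Y" "r \<le> n" "n \<le> m"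
    and "(\<Sum>i\<le>n. scale (d i) (T_family Y r u i)) = 0" "i \<le> n"
  shows "d i = d 0 * coeff_family r u i"
proof (cases "i = 0")
  case False
  have "{1..n} \<subseteq> {1..m}" using assms(3) by auto
  then have "inj_on Y {1..n}" "independent (Y ` {1..n})"
    using assms(1) inj_on_subset independent_mono[OF _ image_mono]
    unfolding is_ordered_basis_def by blast+
  then show ?thesis
    using independent_family_coeff[of "{1..n}" Y "\<lambda>i. d i - d 0 * coeff_family r u i" i] assms False
    by (simp add: T_family_sum)
qed (simp add: coeff_family_def)

text \<open>A relation over the small field is \<open>\<iota> (e 0)\<close> times
  \<open>coeff_family\<close>. At index 1 this reads
  \<open>\<iota> (e 1) = \<iota> (e 0) * u 1\<close>, so independence of 1 and \<open>u 1\<close>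
  forces \<open>e 0 = 0\<close>, and then all of \<open>e\<close> vanishes. The case
  \<open>r = 0\<close> has to be excluded because the generator at index 0 would be zero.\<close>

lemma T_family_independent:
  assumes "is_ordered_basis scale m Y" "1 \<le> r" "r \<le> n" "n \<le> m"
    and "L.dim (U_space \<iota> r u) = r + 1"
    and "(\<Sum>i\<le>n. scale (\<iota> (e i)) (T_family Y r u i)) = 0" "i \<le> n"
  shows "e i = 0"
proof -
  have e: "\<iota> (e i) = \<iota> (e 0) * coeff_family r u i" if "i \<le> n" for i
    using T_family_relation_unique[OF assms(1,3,4,6) that] .
  \<comment> \<open>Coefficients of the relation between 1 and \<open>u 1\<close> that arises from
    index 1; the goal \<open>c 1 = 0\<close> means \<open>e 0 = 0\<close>.\<close>
  define c where "c i = (if i = 0 then - e 1 else if i = 1 then e 0 else 0)" for i :: nat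
  have "(\<Sum>i\<le>r. \<iota> (c i) * coeff_family r u i)
      = (\<Sum>i\<in>{0,1}. \<iota> (c i) * coeff_family r u i)"
    using assms(2) by (intro sum.mono_neutral_right) (auto simp: c_def \<iota>_simps)
  also have "\<dots> = 0"
    using e[of 1] assms(2,3) by (simp add: c_def \<iota>_simps coeff_family_def)
  finally have "c 1 = 0" by (rule coeff_family_independent[OF assms(5)]) fact
  then show ?thesis using e[OF assms(7)] by (simp add: c_def \<iota>_simps)
qed

section \<open>From a scalar multiple of the coefficient space to a linear automorphism\<close>

lemma bij_if_basis_in_range:
  assumes "is_ordered_basis scale m Y" "Vector_Spaces.linear scale scale g"
    and "\<And>i. i \<in> {1..m} \<Longrightarrow> Y i \<in> range g"
  shows "bij g"
proof -
  interpret finite_dimensional_vector_space scale "Y ` {1..m}"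
    using assms(1) by unfold_locales (auto simp: is_ordered_basis_def)
  interpret g: Vector_Spaces.linear scale scale g by fact
  have "span (Y ` {1..m}) \<subseteq> range g"
    using assms(3) by (intro span_minimal g.subspace_image subspace_UNIV) auto
  then have "surj g" using assms(1) by (auto simp: is_ordered_basis_def)
  then show ?thesis
    using linear_surj_imp_inj[OF assms(2)] by (simp add: bij_def)
qed

text \<open>The matrix \<open>a\<close> expresses \<open>coeff_family r u'\<close> through
  \<open>c\<close> times \<open>coeff_family r u\<close>. Its transpose, applied to the generators
  for \<open>u'\<close>, gives vectors \<open>s\<close> satisfying the relation for
  \<open>u\<close>. Sending \<open>Y i\<close> to \<open>s i\<close> for
  \<open>1 \<le> i \<le> r\<close> and fixing the other basis vectors therefore also sends the
  generator at index 0 to \<open>s 0\<close>.\<close>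

lemma T_orbit_if_U_orbit:
  assumes Y: "is_ordered_basis scale m Y" and rn: "r \<le> n" "n \<le> m"
    and dim: "L.dim (U_space \<iota> r u') = r + 1"
    and "c \<noteq> 0" and U: "U_space \<iota> r u' = (*) c ` U_space \<iota> r u"
  shows "\<exists>g\<in>general_linear_group scale.
    K.span (T_family Y r u' ` {..n}) = g ` K.span (T_family Y r u ` {..n})"
proof -
  let ?x = "coeff_family r u" and ?x' = "coeff_family r u'"
  let ?t = "T_family Y r u" and ?t' = "T_family Y r u'"
  have "\<forall>j\<in>{..r}. \<exists>e. ?x' j = c * (\<Sum>i\<le>r. \<iota> (e i) * ?x i)"
  proof
    fix j assume "j \<in> {..r}"
    then have "?x' j \<in> (*) c ` L.span (?x ` {..r})"
      using U by (auto simp: U_space_eq_span intro: L.span_base)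
    then show "\<exists>e. ?x' j = c * (\<Sum>i\<le>r. \<iota> (e i) * ?x i)" by (auto simp: L_span_family)
  qed
  from bchoice[OF this] obtain a where a: "\<And>j. j \<le> r \<Longrightarrow> ?x' j = c * (\<Sum>i\<le>r. \<iota> (a j i) * ?x i)"
    by blast
  have "\<forall>i\<in>{..r}. \<exists>e. c * ?x i = (\<Sum>j\<le>r. \<iota> (e j) * ?x' j)"
  proof
    fix i assume "i \<in> {..r}"
    then have "c * ?x i \<in> L.span (?x' ` {..r})"
      using U by (auto simp: U_space_eq_span intro: L.span_base)
    then show "\<exists>e. c * ?x i = (\<Sum>j\<le>r. \<iota> (e j) * ?x' j)" by (auto simp: L_span_family)
  qed
  from bchoice[OF this] obtain b where b: "\<And>i. i \<le> r \<Longrightarrow> c * ?x i = (\<Sum>j\<le>r. \<iota> (b i j) * ?x' j)"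
    by blast
  \<comment> \<open>The matrices \<open>a\<close> and \<open>b\<close> are mutually inverse:
    substituting one expansion into the other gives \<open>?x' j\<close> in terms of
    \<open>?x'\<close>, whose independence comes from \<open>dim\<close>.\<close>
  have ba: "(\<Sum>i\<le>r. b i k * a j i) = (if k = j then 1 else 0)" if "j \<le> r" "k \<le> r" for j k
  proof -
    have "?x' j = (\<Sum>i\<le>r. \<iota> (a j i) * (c * ?x i))"
      unfolding a[OF that(1)] sum_distrib_left by (simp add: mult.left_commute)
    also have "\<dots> = (\<Sum>i\<le>r. \<Sum>k\<le>r. \<iota> (b i k) * \<iota> (a j i) * ?x' k)"
      by (intro sum.cong) (auto simp: b sum_distrib_left mult_ac)
    also have "\<dots> = (\<Sum>k\<le>r. \<Sum>i\<le>r. \<iota> (b i k) * \<iota> (a j i) * ?x' k)"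
      by (rule sum.swap)
    also have "\<dots> = (\<Sum>k\<le>r. \<iota> (\<Sum>i\<le>r. b i k * a j i) * ?x' k)"
      by (simp add: \<iota>_simps sum_distrib_right)
    finally have "?x' j = (\<Sum>k\<le>r. \<iota> (\<Sum>i\<le>r. b i k * a j i) * ?x' k)" .
    moreover have "?x' j = (\<Sum>k\<le>r. \<iota> (if k = j then 1 else 0) * ?x' k)"
      using that by (simp add: if_distrib[where f="\<lambda>c. \<iota> c * _"] \<iota>_simps cong: if_cong)
    ultimately have
      "(\<Sum>k\<le>r. \<iota> ((\<Sum>i\<le>r. b i k * a j i) - (if k = j then 1 else 0)) * ?x' k) = 0"
      by (simp only: diff_conv_add_uminus \<iota>_add \<iota>_uminus distrib_right minus_mult_left[symmetric]
          sum.distrib sum_negf) simp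
    from coeff_family_independent[OF dim this that(2)] show ?thesis by simp
  qed
  \<comment> \<open>The indices of \<open>a\<close> are transposed here, so that the sum over
    \<open>i\<close> below collects the expansion of a single \<open>?x' j\<close>, up to the factor
    \<open>inverse c\<close>.\<close>
  define s where "s i = (\<Sum>j\<le>r. scale (\<iota> (a j i)) (?t' j))" for i
  have s_rel: "(\<Sum>i\<le>r. scale (?x i) (s i)) = 0"
  proof -
    have "(\<Sum>i\<le>r. ?x i * \<iota> (a j i)) = inverse c * ?x' j" if "j \<le> r" for j
      using a[OF that] \<open>c \<noteq> 0\<close> by (simp add: field_simps)
    moreover have "(\<Sum>i\<le>r. scale (?x i) (s i))
        = (\<Sum>j\<le>r. scale (\<Sum>i\<le>r. ?x i * \<iota> (a j i)) (?t' j))"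
      unfolding s_def by (rule sum_scale_swap)
    ultimately have "(\<Sum>i\<le>r. scale (?x i) (s i))
        = scale (inverse c) (\<Sum>j\<le>r. scale (?x' j) (?t' j))"
      by (simp add: scale_sum_right)
    then show ?thesis by (simp add: T_family_relation)
  qed
  interpret vector_space_pair scale scale by unfold_locales
  have ind: "inj_on Y {1..m}" "independent (Y ` {1..m})"
    using Y by (auto simp: is_ordered_basis_def)
  \<comment> \<open>\<open>the_inv_into\<close> recovers the index of a basis vector, which turns
    the prescription by indices into one on vectors.\<close>
  from linear_independent_extend[OF ind(2), of "\<lambda>v. let i = the_inv_into {1..m} Y v in
      if i \<le> r then s i else v"]
  obtain g where lin: "Vector_Spaces.linear scale scale g"
    and "\<forall>v\<in>Y ` {1..m}. g v = (let i = the_inv_into {1..m} Y v in if i \<le> r then s i else v)"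
    by blast
  then have gY: "g (Y i) = (if i \<le> r then s i else Y i)" if "i \<in> {1..m}" for i
    using that ind(1) by (auto simp: the_inv_into_f_f)
  interpret g: Vector_Spaces.linear scale scale g by fact
  \<comment> \<open>Index 0 cannot be prescribed, since that generator is a combination of the
    \<open>Y i\<close>; its image is forced, and \<open>s_rel\<close> identifies it as
    \<open>s 0\<close>.\<close>
  have gt0: "g (?t 0) = s 0"
  proof -
    have "g (?t 0) = - (\<Sum>i=1..r. scale (?x i) (s i))"
      using rn by (auto simp: T_family_def g.neg g.sum g.scale gY coeff_family_def
          intro!: sum.cong)
    also have "\<dots> = s 0 - (\<Sum>i\<le>r. scale (?x i) (s i))"
      unfolding atMost_eq_insert by (simp add: coeff_family_def)
    finally show ?thesis by (simp add: s_rel)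
  qed
  have gt: "g (?t i) = (if i \<le> r then s i else ?t' i)" if "i \<le> m" for i
    using that gY[of i] gt0 by (cases "i = 0") (auto simp: T_family_def)
  \<comment> \<open>The inverse matrix \<open>b\<close> recovers the generators for
    \<open>u'\<close> from the images under \<open>g\<close>. This serves both surjectivity of
    \<open>g\<close> and equality of the spans.\<close>
  have t': "?t' k = (\<Sum>i\<le>r. scale (\<iota> (b i k)) (g (?t i)))" if "k \<le> r" for k
  proof -
    have "(\<Sum>i\<le>r. scale (\<iota> (b i k)) (g (?t i)))
        = (\<Sum>j\<le>r. scale (\<iota> (\<Sum>i\<le>r. b i k * a j i)) (?t' j))"
      using rn by (simp add: gt s_def sum_scale_swap \<iota>_simps)
    also have "\<dots> = (\<Sum>j\<le>r. if k = j then ?t' j else 0)"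
      using that by (intro sum.cong) (auto simp: ba \<iota>_simps)
    also have "\<dots> = ?t' k" using that by simp
    finally show ?thesis by simp
  qed
  have "bij g"
  proof (rule bij_if_basis_in_range[OF Y lin])
    fix i assume i: "i \<in> {1..m}"
    show "Y i \<in> range g"
    proof (cases "i \<le> r")
      case True
      then have "Y i = g (\<Sum>j\<le>r. scale (\<iota> (b j i)) (?t j))"
        using t'[of i] i by (simp add: T_family_def[of _ _ u'] g.sum g.scale)
      then show ?thesis by blast
    next
      case False
      then have "Y i = g (Y i)" using gY i by simp
      then show ?thesis by blast
    qed
  qed
  moreover have "K.span (?t' ` {..n}) = K.span ((\<lambda>i. g (?t i)) ` {..n})"
    unfolding K.span_eq
  proof safe
    fix i assume i: "i \<le> n"
    show "?t' i \<in> K.span ((\<lambda>i. g (?t i)) ` {..n})"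
    proof (cases "i \<le> r")
      case True
      have "(\<Sum>j\<le>r. restrict_scalars \<iota> scale (b j i) (g (?t j)))
          \<in> K.span ((\<lambda>i. g (?t i)) ` {..n})"
        using rn by (intro K.span_sum K.span_scale K.span_base) auto
      then show ?thesis using t'[OF True] by (simp add: restrict_scalars_def)
    next
      case False
      then have "?t' i = g (?t i)" using gt i rn by simp
      then show ?thesis using i by (auto intro: K.span_base)
    qed
    show "g (?t i) \<in> K.span (?t' ` {..n})"
    proof (cases "i \<le> r")
      case True
      have "(\<Sum>j\<le>r. restrict_scalars \<iota> scale (a j i) (?t' j)) \<in> K.span (?t' ` {..n})"
        using rn by (intro K.span_sum K.span_scale K.span_base) auto
      then show ?thesis using gt[of i] True i rn by (simp add: restrict_scalars_def s_def)
    next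
      case False
      then show ?thesis using gt[of i] i rn by (auto intro: K.span_base)
    qed
  qed
  ultimately show ?thesis
    using lin by (auto simp: general_linear_group_def linear_image_span image_image)
qed

section \<open>From a linear automorphism to a scalar multiple, and the equivalence\<close>

text \<open>The relations of both families have coefficients \<open>coeff_family\<close>, padded
  with zeros up to \<open>n\<close>, so \<open>relation_span_transfer\<close> applies. It delivers
  the space of \<open>u\<close> as a multiple of that of \<open>u'\<close>; the scalar has to be
  inverted afterwards.\<close>

lemma U_orbit_if_T_orbit:
  assumes Y: "is_ordered_basis scale m Y" and rn: "1 \<le> r" "r \<le> n" "n \<le> m"
    and dim: "L.dim (U_space \<iota> r u) = r + 1"
    and g: "g \<in> general_linear_group scale"
    and T: "K.span (T_family Y r u' ` {..n}) = g ` K.span (T_family Y r u ` {..n})"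
  shows "\<exists>d. d \<noteq> 0 \<and> U_space \<iota> r u = (*) d ` U_space \<iota> r u'"
  unfolding U_space_eq_span_extended[OF rn(2)]
proof (rule relation_span_transfer)
  show "Vector_Spaces.linear scale scale g" "inj g"
    using g by (auto simp: general_linear_group_def bij_def)
  show "g ` K.span (T_family Y r u ` {..n}) = K.span (T_family Y r u' ` {..n})"
    using T by simp
  show "(\<Sum>i\<le>n. scale (coeff_family r u i) (T_family Y r u i)) = 0"
    using rn by (simp add: T_family_sum coeff_family_def)
  show "coeff_family r u 0 \<noteq> 0" by (simp add: coeff_family_def)
qed (fact T_family_independent[OF Y rn dim] T_family_relation_unique[OF Y rn(2,3)])+

end

theorem lemma3p2:
  fixes \<iota> :: "'k::{field,finite} \<Rightarrow> 'a::{field,finite}"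
    and scale :: "'a \<Rightarrow> 'v::ab_group_add \<Rightarrow> 'v"
    and Y :: "nat \<Rightarrow> 'v"
    and u u' :: "nat \<Rightarrow> 'a"
    and q m l k r :: nat
  assumes "primepow q" and "CARD('k) = q" and "CARD('a) = q ^ l"
    and "field_embedding \<iota>"
    and "vector_space scale" and "is_ordered_basis scale m Y"
    and "3 \<le> k" and "k \<le> min (m + 1) l"
    and "1 \<le> r" and "r \<le> k - 1"
    and "vector_space.dim (restrict_scalars \<iota> (*)) (U_space \<iota> r u) = r + 1"
    and "vector_space.dim (restrict_scalars \<iota> (*)) (U_space \<iota> r u') = r + 1"
  shows "T_space \<iota> scale Y k r u'
           \<in> subspace_orbit (general_linear_group scale) (T_space \<iota> scale Y k r u)
         \<longleftrightarrow> U_space \<iota> r u' \<in> subspace_orbit singer_cycle (U_space \<iota> r u)"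
proof -
  interpret vector_space scale by fact
  interpret restricted_space scale \<iota> by unfold_locales fact
  \<comment> \<open>The \<open>k\<close> generators are numbered from 0 to \<open>k - 1\<close> and
    involve only \<open>Y 1, ..., Y (k - 1)\<close>; the bound \<open>k \<le> m + 1\<close> places
    these in the basis.\<close>
  have "k - 1 \<le> m" using assms(8) by (auto simp: min_def split: if_splits)
  show ?thesis
  proof
    assume "T_space \<iota> scale Y k r u'
      \<in> subspace_orbit (general_linear_group scale) (T_space \<iota> scale Y k r u)"
    then obtain g where "g \<in> general_linear_group scale"
      "K.span (T_family Y r u' ` {..k - 1}) = g ` K.span (T_family Y r u ` {..k - 1})"
      by (auto simp: subspace_orbit_def T_space_eq_span)
    from U_orbit_if_T_orbit[OF assms(6,9,10) \<open>k - 1 \<le> m\<close> assms(11) this]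
    obtain d where "d \<noteq> 0" and d: "U_space \<iota> r u = (*) d ` U_space \<iota> r u'" by blast
    then have "U_space \<iota> r u' = (*) (inverse d) ` U_space \<iota> r u"
      by (simp add: image_image mult.assoc[symmetric])
    then show "U_space \<iota> r u' \<in> subspace_orbit singer_cycle (U_space \<iota> r u)"
      using \<open>d \<noteq> 0\<close> unfolding subspace_orbit_def singer_cycle_def
      by (auto intro!: exI[of _ "(*) (inverse d)"] exI[of _ "inverse d"])
  next
    assume "U_space \<iota> r u' \<in> subspace_orbit singer_cycle (U_space \<iota> r u)"
    then obtain c where "c \<noteq> 0" "U_space \<iota> r u' = (*) c ` U_space \<iota> r u"
      by (auto simp: subspace_orbit_def singer_cycle_def)
    from T_orbit_if_U_orbit[OF assms(6,10) \<open>k - 1 \<le> m\<close> assms(12) this]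
    show "T_space \<iota> scale Y k r u'
      \<in> subspace_orbit (general_linear_group scale) (T_space \<iota> scale Y k r u)"
      by (auto simp: subspace_orbit_def T_space_eq_span)
  qed
qed

end
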